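(* Let the Kraus–Lehmann logic be the bimodal logic with operators $K_i$ (knowledge) and $B_i$ (belief) axiomatized by: all propositional tautologies; $K_i(\varphi\to\psi)\to(K_i\varphi\to K_i\psi)$; $K_i\varphi\to\varphi$; $\neg K_i\varphi\to K_i\neg K_i\varphi$; $B_i(\varphi\to\psi)\to(B_i\varphi\to B_i\psi)$; $B_i\varphi\to\neg B_i\neg\varphi$; $K_i\varphi\to B_i\varphi$; $B_i\varphi\to K_iB_i\varphi$; modus ponens; and necessitation for $K_i$ (from $\vdash\varphi$ infer $\vdash K_i\varphi$). Assume the language expresses Löb sentences, i.e., for each operator $\Box\in\{K_i,B_i\}$ and every formula $\varphi$ there is a formula $\psi$ with $\vdash\Box(\psi\leftrightarrow(\Box\psi\to\varphi))$. Then this logic crashes.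
   Context: "Löb's Theorem for $\Box$" is the scheme $\Box(\Box\varphi\to\varphi)\to\Box\varphi$ for all $\varphi$. The accessibility relation for $K_i$ is reflexive (Truth axiom) and that for $B_i$ is serial (axiom $B_i\varphi\to\neg B_i\neg\varphi$). Definition: a modal logic with operators $\Box_i$ defined by relations $\mathcal{R}_i$ crashes if and only if its axioms derive Löb's Theorem for at least one $\Box_i$ and $\mathcal{R}_i$ is serial or reflexive. *)

theory Defs
  imports Main
begin

text \<open>
  Propositional multimodal formulas over atoms \<open>'a\<close>, with one necessity operator for each index
  in \<open>'m\<close>.
\<close>

datatype ('m, 'a) fm =
    Atom 'a
  | Falsum
  | Imp "('m, 'a) fm" "('m, 'a) fm" (infixr "\<^bold>\<rightarrow>" 55)
  | Box 'm "('m, 'a) fm"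

abbreviation Neg :: "('m, 'a) fm \<Rightarrow> ('m, 'a) fm" ("\<^bold>\<not> _" [70] 70) where
  "\<^bold>\<not> \<phi> \<equiv> \<phi> \<^bold>\<rightarrow> Falsum"

abbreviation Conj :: "('m, 'a) fm \<Rightarrow> ('m, 'a) fm \<Rightarrow> ('m, 'a) fm" (infixr "\<^bold>\<and>" 65) where
  "\<phi> \<^bold>\<and> \<psi> \<equiv> \<^bold>\<not> (\<phi> \<^bold>\<rightarrow> \<^bold>\<not> \<psi>)"

abbreviation Iff :: "('m, 'a) fm \<Rightarrow> ('m, 'a) fm \<Rightarrow> ('m, 'a) fm" (infix "\<^bold>\<leftrightarrow>" 53) where
  "\<phi> \<^bold>\<leftrightarrow> \<psi> \<equiv> (\<phi> \<^bold>\<rightarrow> \<psi>) \<^bold>\<and> (\<psi> \<^bold>\<rightarrow> \<phi>)"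

text \<open>
  Propositional tautologies: the valuation treats boxed formulas, like atoms, as unanalysed.
\<close>

primrec prop_eval :: "('a \<Rightarrow> bool) \<Rightarrow> ('m \<Rightarrow> ('m, 'a) fm \<Rightarrow> bool) \<Rightarrow> ('m, 'a) fm \<Rightarrow> bool" where
  "prop_eval g h (Atom p) = g p"
| "prop_eval g h Falsum = False"
| "prop_eval g h (\<phi> \<^bold>\<rightarrow> \<psi>) = (prop_eval g h \<phi> \<longrightarrow> prop_eval g h \<psi>)"
| "prop_eval g h (Box m \<phi>) = h m \<phi>"

definition tautology :: "('m, 'a) fm \<Rightarrow> bool" where
  "tautology \<phi> \<longleftrightarrow> (\<forall>g h. prop_eval g h \<phi>)"

primrec sat :: "('m \<Rightarrow> 'w \<Rightarrow> 'w \<Rightarrow> bool) \<Rightarrow> ('w \<Rightarrow> 'a \<Rightarrow> bool) \<Rightarrow> 'w \<Rightarrow> ('m, 'a) fm \<Rightarrow> bool" where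
  "sat R V w (Atom p) = V w p"
| "sat R V w Falsum = False"
| "sat R V w (\<phi> \<^bold>\<rightarrow> \<psi>) = (sat R V w \<phi> \<longrightarrow> sat R V w \<psi>)"
| "sat R V w (Box m \<phi>) = (\<forall>u. R m w u \<longrightarrow> sat R V u \<phi>)"

definition valid_on_frame :: "('m \<Rightarrow> 'w \<Rightarrow> 'w \<Rightarrow> bool) \<Rightarrow> ('m, 'a) fm \<Rightarrow> bool" where
  "valid_on_frame R \<phi> \<longleftrightarrow> (\<forall>V w. sat R V w \<phi>)"

definition serial :: "('w \<Rightarrow> 'w \<Rightarrow> bool) \<Rightarrow> bool" where
  "serial r \<longleftrightarrow> (\<forall>w. \<exists>u. r w u)"

definition derives_Loeb :: "(('m, 'a) fm \<Rightarrow> bool) \<Rightarrow> 'm \<Rightarrow> bool" where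
  "derives_Loeb prv m \<longleftrightarrow> (\<forall>\<phi>. prv (Box m (Box m \<phi> \<^bold>\<rightarrow> \<phi>) \<^bold>\<rightarrow> Box m \<phi>))"

text \<open>
  A modal logic is given by its derivability predicate together with the accessibility relations
  of its operators.
\<close>

definition crashes :: "(('m, 'a) fm \<Rightarrow> bool) \<Rightarrow> ('m \<Rightarrow> 'w \<Rightarrow> 'w \<Rightarrow> bool) \<Rightarrow> bool" where
  "crashes prv R \<longleftrightarrow> (\<exists>m. derives_Loeb prv m \<and> (serial (R m) \<or> reflp (R m)))"

definition expresses_Loeb_sentences :: "(('m, 'a) fm \<Rightarrow> bool) \<Rightarrow> bool" where
  "expresses_Loeb_sentences prv \<longleftrightarrow>
    (\<forall>m \<phi>. \<exists>\<psi>. prv (Box m (\<psi> \<^bold>\<leftrightarrow> (Box m \<psi> \<^bold>\<rightarrow> \<phi>))))"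

datatype 'i modality = Knows 'i | Believes 'i

abbreviation K :: "'i \<Rightarrow> ('i modality, 'a) fm \<Rightarrow> ('i modality, 'a) fm" where
  "K i \<equiv> Box (Knows i)"

abbreviation B :: "'i \<Rightarrow> ('i modality, 'a) fm \<Rightarrow> ('i modality, 'a) fm" where
  "B i \<equiv> Box (Believes i)"

inductive KL_axiom :: "('i modality, 'a) fm \<Rightarrow> bool" where
  Taut: "tautology \<phi> \<Longrightarrow> KL_axiom \<phi>"
| K_distr: "KL_axiom (K i (\<phi> \<^bold>\<rightarrow> \<psi>) \<^bold>\<rightarrow> (K i \<phi> \<^bold>\<rightarrow> K i \<psi>))"
| K_truth: "KL_axiom (K i \<phi> \<^bold>\<rightarrow> \<phi>)"
| K_neg_intro: "KL_axiom (\<^bold>\<not> K i \<phi> \<^bold>\<rightarrow> K i (\<^bold>\<not> K i \<phi>))"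
| B_distr: "KL_axiom (B i (\<phi> \<^bold>\<rightarrow> \<psi>) \<^bold>\<rightarrow> (B i \<phi> \<^bold>\<rightarrow> B i \<psi>))"
| B_consistent: "KL_axiom (B i \<phi> \<^bold>\<rightarrow> \<^bold>\<not> B i (\<^bold>\<not> \<phi>))"
| K_imp_B: "KL_axiom (K i \<phi> \<^bold>\<rightarrow> B i \<phi>)"
| B_imp_KB: "KL_axiom (B i \<phi> \<^bold>\<rightarrow> K i (B i \<phi>))"

text \<open>
  The Kraus--Lehmann calculus, relative to a set \<open>\<Gamma>\<close> of further axioms that fix how atoms of the
  language are to be read; \<open>KL {}\<close> is the bare calculus.  A freely generated language contains no
  formula that refers to itself, and \<open>KL {}\<close> does not derive the Loeb equivalences (it is sound
  for a one-world reflexive frame, where \<open>Box m (\<psi> \<^bold>\<leftrightarrow> (Box m \<psi> \<^bold>\<rightarrow> Falsum))\<close> fails).  A language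
  that does express Loeb sentences has atoms that abbreviate them, and \<open>\<Gamma>\<close> contains the
  corresponding equivalences.  The accessibility relations are determined by \<open>KL_axiom\<close> alone,
  because no frame with a reflexive relation for \<open>m\<close> validates that equivalence.
\<close>

inductive KL :: "('i modality, 'a) fm set \<Rightarrow> ('i modality, 'a) fm \<Rightarrow> bool" for \<Gamma> where
  Axiom: "KL_axiom \<phi> \<Longrightarrow> KL \<Gamma> \<phi>"
| Language: "\<phi> \<in> \<Gamma> \<Longrightarrow> KL \<Gamma> \<phi>"
| MP: "KL \<Gamma> \<phi> \<Longrightarrow> KL \<Gamma> (\<phi> \<^bold>\<rightarrow> \<psi>) \<Longrightarrow> KL \<Gamma> \<psi>"
| Nec: "KL \<Gamma> \<phi> \<Longrightarrow> KL \<Gamma> (K i \<phi>)"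

end

theory Submission
  imports Defs
begin

text \<open>
  Already knowledge crashes, by Curry's paradox.  If \<open>K (\<psi> \<leftrightarrow> (K \<psi> \<rightarrow> \<phi>))\<close> is derivable, the Truth
  axiom removes the outer \<open>K\<close>.  Truth for \<open>\<psi>\<close> then gives \<open>K \<psi> \<rightarrow> \<phi>\<close>, hence \<open>\<psi>\<close>, by necessitation
  \<open>K \<psi>\<close>, and so \<open>\<phi>\<close>.  The logic thus derives every formula, in particular every instance of Loeb's
  Theorem.
\<close>

lemma KL_tautology: "tautology \<phi> \<Longrightarrow> KL \<Gamma> \<phi>"
  by (intro KL.Axiom KL_axiom.Taut)

lemma KL_Knows_Loeb_sentence_imp:
  assumes "KL \<Gamma> (K i (\<psi> \<^bold>\<leftrightarrow> (K i \<psi> \<^bold>\<rightarrow> \<phi>)))"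
  shows "KL \<Gamma> \<phi>"
proof -
  have truth: "KL \<Gamma> (K i \<chi> \<^bold>\<rightarrow> \<chi>)" for \<chi>
    by (intro KL.Axiom KL_axiom.K_truth)
  have equiv: "KL \<Gamma> (\<psi> \<^bold>\<leftrightarrow> (K i \<psi> \<^bold>\<rightarrow> \<phi>))"
    using assms truth by (rule KL.MP)
  \<comment> \<open>Contraction: \<open>K i \<psi>\<close> serves twice, once to obtain
    \<open>\<psi>\<close> and once to discharge the premise of the implication that
    \<open>\<psi>\<close> asserts.\<close>
  have "KL \<Gamma> ((\<psi> \<^bold>\<leftrightarrow> (K i \<psi> \<^bold>\<rightarrow> \<phi>)) \<^bold>\<rightarrow> (K i \<psi> \<^bold>\<rightarrow> \<psi>) \<^bold>\<rightarrow> K i \<psi> \<^bold>\<rightarrow> \<phi>)"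
    by (rule KL_tautology) (auto simp: tautology_def)
  with equiv truth have imp: "KL \<Gamma> (K i \<psi> \<^bold>\<rightarrow> \<phi>)"
    by (blast intro: KL.MP)
  have "KL \<Gamma> ((\<psi> \<^bold>\<leftrightarrow> (K i \<psi> \<^bold>\<rightarrow> \<phi>)) \<^bold>\<rightarrow> (K i \<psi> \<^bold>\<rightarrow> \<phi>) \<^bold>\<rightarrow> \<psi>)"
    by (rule KL_tautology) (auto simp: tautology_def)
  with equiv imp have "KL \<Gamma> \<psi>"
    by (blast intro: KL.MP)
  then have "KL \<Gamma> (K i \<psi>)"
    by (rule KL.Nec)
  then show ?thesis
    using imp by (rule KL.MP)
qed

lemma expresses_Loeb_sentences_KL_trivial:
  assumes "expresses_Loeb_sentences (KL \<Gamma>)"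
  shows "KL \<Gamma> \<phi>"
  using assms unfolding expresses_Loeb_sentences_def
  by (blast intro: KL_Knows_Loeb_sentence_imp)

lemma reflp_if_valid_truth:
  fixes R :: "'m \<Rightarrow> 'w \<Rightarrow> 'w \<Rightarrow> bool" and p :: 'a
  assumes "valid_on_frame R (Box m (Atom p) \<^bold>\<rightarrow> Atom p)"
  shows "reflp (R m)"
proof (rule reflpI)
  fix w
  \<comment> \<open>Atoms are made true exactly at the successors of \<open>w\<close>, so the boxed
    atom holds at \<open>w\<close> and the axiom puts \<open>w\<close> among them.\<close>
  have "sat R (\<lambda>u _. R m w u) w (Box m (Atom p) \<^bold>\<rightarrow> Atom p)"
    using assms unfolding valid_on_frame_def by blast
  then show "R m w w"
    by simp
qed

theorem theorem3:
  fixes \<Gamma> :: "('i modality, 'a) fm set"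
    and R :: "'i modality \<Rightarrow> 'w \<Rightarrow> 'w \<Rightarrow> bool"
  assumes "\<And>\<phi> :: ('i modality, 'a) fm. KL_axiom \<phi> \<Longrightarrow> valid_on_frame R \<phi>"
    and "expresses_Loeb_sentences (KL \<Gamma>)"
  shows "crashes (KL \<Gamma>) R"
proof -
  \<comment> \<open>Types are nonempty, so an arbitrary agent and atom are available;
    \<open>Knows i\<close> is the operator that crashes.\<close>
  fix i :: 'i and p :: 'a
  have "derives_Loeb (KL \<Gamma>) (Knows i)"
    unfolding derives_Loeb_def
    using expresses_Loeb_sentences_KL_trivial[OF assms(2)] by blast
  moreover have "reflp (R (Knows i))"
    by (rule reflp_if_valid_truth[where p = p], rule assms(1), rule KL_axiom.K_truth)
  ultimately show ?thesis
    unfolding crashes_def by blast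
qed

end
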